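(* Let $N$ be the number of classes, let $w_1,\dots,w_N\in\mathbb{R}^d$ be the current class weight vectors of the last layer of the network, let $(x,y)$ be an input with true class $y\in\{1,\dots,N\}$, and let $K,L\ge 1$ be integers (the LSH parameters). For a class $i\neq y$, let $p_i$ be the probability that class $i$ is sampled as a negative sample by the LSH Label method, i.e. that $i$ is retrieved when the $(K,L)$-parametrized LSH hash tables storing $w_1,\dots,w_N$ are queried with the vector $w_y$. Then $$p_i \;\propto\; 1-\bigl(1-p_{w_y w_i}^{K}\bigr)^{L},$$ where $p_{w_y w_i}$ is the collision probability of $w_y$ and $w_i$ under the LSH family and the constant of proportionality does not depend on $i$. Furthermore, for classes $i,j\neq y$, the probability of sampling class $i$ is greater than that of sampling class $j$ if and only if $sim(w_y,w_i)>sim(w_y,w_j)$, where $sim$ is the underlying similarity function of the LSH family.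
   Context: LSH family: a family $\mathcal{H}$ of hash functions on $\mathbb{R}^d$ with a probability distribution on it, together with a similarity function $sim:\mathbb{R}^d\times\mathbb{R}^d\to\mathbb{R}$, such that the collision probability $p_{uv}:=\Pr_{h\sim\mathcal{H}}(h(u)=h(v))$ satisfies $p_{uv}=f(sim(u,v))$ for all $u,v$, where $f$ is a (strictly) monotonically increasing function. $(K,L)$-parametrized hash tables: draw $K\times L$ independent hash functions $h_{k,t}$ ($1\le k\le K$, $1\le t\le L$) from $\mathcal{H}$. For each table $t=1,\dots,L$ define the meta-hash $H_t(v)=(h_{1,t}(v),\dots,h_{K,t}(v))$. Preprocessing: for every class $i\in\{1,\dots,N\}$ and every $t$, store the index $i$ in the bucket of table $t$ given by $H_t(w_i)$; the buckets are indexed by the meta-hash values. Querying with a vector $q\in\mathbb{R}^d$: for each $t$, look up the bucket of table $t$ given by $H_t(q)$; the set of retrieved samples is the union over $t=1,\dots,L$ of the contents of these buckets. Thus class $i$ is retrieved if and only if $H_t(q)=H_t(w_i)$ for at least one $t$. LSH Label method: for the input $(x,y)$, query with $q=w_y$, the weight vector of the true class; the retrieved classes other than $y$ are the negative samples. Probabilities are over the random choice of hash functions, with the input and the current weight vectors held fixed. *)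

theory Defs
  imports "HOL-Probability.Probability"
begin

text \<open>A family of hash functions on \<open>\<real>\<^sup>d\<close> with a distribution on it is a probability measure on
  the function type; \<open>'b\<close> is the type of hash values.\<close>

definition collision_prob ::
  "(real ^ 'd \<Rightarrow> 'b) measure \<Rightarrow> real ^ 'd \<Rightarrow> real ^ 'd \<Rightarrow> real" where
  "collision_prob H u v = measure H {g \<in> space H. g u = g v}"

text \<open>Measurability of the collision events is part of the definition, since \<open>measure\<close> is \<open>0\<close> on
  non-measurable sets.  The function \<open>f\<close> is only constrained on values that \<open>sim\<close> takes.\<close>

definition lsh_family ::
  "(real ^ 'd \<Rightarrow> 'b) measure \<Rightarrow> (real ^ 'd \<Rightarrow> real ^ 'd \<Rightarrow> real) \<Rightarrow> bool" where
  "lsh_family H sim \<longleftrightarrow>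
     prob_space H \<and>
     (\<forall>u v. {g \<in> space H. g u = g v} \<in> sets H) \<and>
     (\<exists>f :: real \<Rightarrow> real.
        strict_mono_on (range (\<lambda>(u, v). sim u v)) f \<and>
        (\<forall>u v. collision_prob H u v = f (sim u v)))"

text \<open>\<open>h k t\<close>, for \<open>1 \<le> k \<le> K\<close> and \<open>1 \<le> t \<le> L\<close>, are independent random hash functions on the
  probability space \<open>M\<close>, each with law \<open>H\<close>; \<open>indep_vars\<close> includes their measurability.\<close>

definition iid_hashes ::
  "'a measure \<Rightarrow> (real ^ 'd \<Rightarrow> 'b) measure \<Rightarrow> nat \<Rightarrow> nat \<Rightarrow>
   (nat \<Rightarrow> nat \<Rightarrow> 'a \<Rightarrow> (real ^ 'd \<Rightarrow> 'b)) \<Rightarrow> bool" where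
  "iid_hashes M H K L h \<longleftrightarrow>
     prob_space M \<and>
     prob_space.indep_vars M (\<lambda>_. H) (\<lambda>(k, t). h k t) ({1..K} \<times> {1..L}) \<and>
     (\<forall>k\<in>{1..K}. \<forall>t\<in>{1..L}. distr M H (h k t) = H)"

definition meta_hash ::
  "nat \<Rightarrow> (nat \<Rightarrow> nat \<Rightarrow> (real ^ 'd \<Rightarrow> 'b)) \<Rightarrow> nat \<Rightarrow> real ^ 'd \<Rightarrow> 'b list" where
  "meta_hash K g t v = map (\<lambda>k. g k t v) [1..<Suc K]"

definition bucket ::
  "nat \<Rightarrow> (nat \<Rightarrow> nat \<Rightarrow> (real ^ 'd \<Rightarrow> 'b)) \<Rightarrow> nat \<Rightarrow> (nat \<Rightarrow> real ^ 'd) \<Rightarrow> nat \<Rightarrow> 'b list \<Rightarrow> nat set"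
  where
  "bucket K g N w t b = {i \<in> {1..N}. meta_hash K g t (w i) = b}"

definition retrieved ::
  "nat \<Rightarrow> nat \<Rightarrow> (nat \<Rightarrow> nat \<Rightarrow> (real ^ 'd \<Rightarrow> 'b)) \<Rightarrow> nat \<Rightarrow> (nat \<Rightarrow> real ^ 'd) \<Rightarrow> real ^ 'd \<Rightarrow> nat set"
  where
  "retrieved K L g N w q = (\<Union>t\<in>{1..L}. bucket K g N w t (meta_hash K g t q))"

text \<open>The LSH Label method uses only the label \<open>y\<close> of the input \<open>(x, y)\<close>.\<close>

definition lsh_label_negatives ::
  "nat \<Rightarrow> nat \<Rightarrow> (nat \<Rightarrow> nat \<Rightarrow> (real ^ 'd \<Rightarrow> 'b)) \<Rightarrow> nat \<Rightarrow> (nat \<Rightarrow> real ^ 'd) \<Rightarrow> 'x \<times> nat \<Rightarrow> nat set"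
  where
  "lsh_label_negatives K L g N w = (\<lambda>(x, y). retrieved K L g N w (w y) - {y})"

definition lsh_label_prob ::
  "'a measure \<Rightarrow> nat \<Rightarrow> nat \<Rightarrow> (nat \<Rightarrow> nat \<Rightarrow> 'a \<Rightarrow> (real ^ 'd \<Rightarrow> 'b)) \<Rightarrow>
   nat \<Rightarrow> (nat \<Rightarrow> real ^ 'd) \<Rightarrow> 'x \<times> nat \<Rightarrow> nat \<Rightarrow> real" where
  "lsh_label_prob M K L h N w xy i =
     measure M {\<omega> \<in> space M. i \<in> lsh_label_negatives K L (\<lambda>k t. h k t \<omega>) N w xy}"

end

theory Submission imports Defs begin

text \<open>Fix a class \<open>i\<close> other than \<open>y\<close> and let \<open>p\<close> be the
  collision probability of \<open>w y\<close> and \<open>w i\<close>. The events that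
  \<open>h k t\<close> agrees on these two vectors are independent over all \<open>(k, t)\<close>
  and each has probability \<open>p\<close>. Table \<open>t\<close> yields \<open>i\<close> exactly
  when all \<open>K\<close> events of that table occur, which has probability \<open>p ^ K\<close>.
  Different tables use disjoint sets of hash functions, so all \<open>L\<close> tables miss
  \<open>i\<close> with probability \<open>(1 - p ^ K) ^ L\<close>
  (\<open>prob_bex_ball_indep\<close>, \<open>lsh_label_prob_eq\<close>). The complement is the
  claimed formula, with constant 1. On [0,1] this expression is strictly increasing in
  \<open>p\<close> (\<open>amplification_less_iff\<close>), and \<open>p\<close> is a strictly
  increasing function of the similarity, so the two orderings coincide.\<close>

lemma (in prob_space) prob_ball_indep:
  assumes "indep_vars (\<lambda>_. count_space UNIV) X I" "finite I" "I \<noteq> {}"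
  shows "prob {\<omega> \<in> space M. \<forall>i\<in>I. X i \<omega>} = (\<Prod>i\<in>I. prob {\<omega> \<in> space M. X i \<omega>})"
proof -
  have "prob (\<Inter>i\<in>I. X i -` {True} \<inter> space M) = (\<Prod>i\<in>I. prob (X i -` {True} \<inter> space M))"
    by (rule indep_varsD[OF assms(1)]) (use assms in auto)
  \<comment> \<open>An empty intersection would be \<open>UNIV\<close> rather than
    \<open>space M\<close>, hence the assumption that \<open>I\<close> is nonempty.\<close>
  moreover have "(\<Inter>i\<in>I. X i -` {True} \<inter> space M) = {\<omega> \<in> space M. \<forall>i\<in>I. X i \<omega>}"
    using assms(3) by auto
  moreover have "X i -` {True} \<inter> space M = {\<omega> \<in> space M. X i \<omega>}" for i
    by auto
  ultimately show ?thesis by simp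
qed

text \<open>The product rule is applied twice: inside a table to the \<open>K\<close> events, and
  across tables to the \<open>L\<close> failures. An existential over tables is not a product event,
  but its negation is.\<close>

lemma (in prob_space) prob_bex_ball_indep:
  fixes X :: "nat \<Rightarrow> nat \<Rightarrow> 'a \<Rightarrow> bool"
  assumes indep: "indep_vars (\<lambda>_. count_space UNIV) (\<lambda>(k, t). X k t) ({1..K} \<times> {1..L})"
    and prob: "\<And>k t. k \<in> {1..K} \<Longrightarrow> t \<in> {1..L} \<Longrightarrow> prob {\<omega> \<in> space M. X k t \<omega>} = p"
    and "K \<ge> 1" "L \<ge> 1"
  shows "prob {\<omega> \<in> space M. \<exists>t\<in>{1..L}. \<forall>k\<in>{1..K}. X k t \<omega>} = 1 - (1 - p ^ K) ^ L"
proof -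
  have meas: "Measurable.pred M (X k t)" if "k \<in> {1..K}" "t \<in> {1..L}" for k t
    using indep that unfolding indep_vars_def by fastforce
  define row where "row t = {1..K} \<times> {t}" for t :: nat
  \<comment> \<open>Grouping an independent family into pairwise disjoint blocks gives independent
    random vectors, one per table; the failure of table \<open>t\<close> is then a measurable
    function of its own vector.\<close>
  have "indep_vars (\<lambda>t. PiM (row t) (\<lambda>_. count_space UNIV))
          (\<lambda>t \<omega>. restrict (\<lambda>i. (case i of (k, t) \<Rightarrow> X k t) \<omega>) (row t)) {1..L}"
    by (rule indep_vars_restrict[OF indep]) (auto simp: row_def disjoint_family_on_def)
  then have "indep_vars (\<lambda>_. count_space UNIV)
      (\<lambda>t. (\<lambda>f. \<not> (\<forall>i\<in>row t. f i)) \<circ> (\<lambda>\<omega>. restrict (\<lambda>i. (case i of (k, t) \<Rightarrow> X k t) \<omega>) (row t))) {1..L}"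
  proof (rule indep_vars_compose)
    fix t
    have [measurable]: "finite (row t)" by (simp add: row_def)
    show "Measurable.pred (PiM (row t) (\<lambda>_. count_space UNIV)) (\<lambda>f. \<not> (\<forall>i\<in>row t. f i))"
      by measurable
  qed
  also have "(\<lambda>t. (\<lambda>f. \<not> (\<forall>i\<in>row t. f i)) \<circ> (\<lambda>\<omega>. restrict (\<lambda>i. (case i of (k, t) \<Rightarrow> X k t) \<omega>) (row t)))
      = (\<lambda>t \<omega>. \<not> (\<forall>k\<in>{1..K}. X k t \<omega>))"
    by (auto simp: row_def fun_eq_iff)
  finally have rows: "indep_vars (\<lambda>_. count_space UNIV) (\<lambda>t \<omega>. \<not> (\<forall>k\<in>{1..K}. X k t \<omega>)) {1..L}" .
  have row_prob: "prob {\<omega> \<in> space M. \<not> (\<forall>k\<in>{1..K}. X k t \<omega>)} = 1 - p ^ K" if t: "t \<in> {1..L}" for t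
  proof -
    have sub: "indep_vars (\<lambda>_. count_space UNIV) (\<lambda>(k, t). X k t) (row t)"
      by (rule indep_vars_subset[OF indep]) (use t in \<open>auto simp: row_def\<close>)
    have "{\<omega> \<in> space M. \<forall>k\<in>{1..K}. X k t \<omega>} = {\<omega> \<in> space M. \<forall>i\<in>row t. (case i of (k, t) \<Rightarrow> X k t) \<omega>}"
      by (auto simp: row_def)
    also have "prob \<dots> = (\<Prod>i\<in>row t. prob {\<omega> \<in> space M. (case i of (k, t) \<Rightarrow> X k t) \<omega>})"
      by (rule prob_ball_indep[OF sub]) (use \<open>K \<ge> 1\<close> in \<open>auto simp: row_def\<close>)
    also have "\<dots> = (\<Prod>i\<in>row t. p)"
      by (rule prod.cong) (use prob t in \<open>auto simp: row_def\<close>)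
    also have "\<dots> = p ^ K" by (simp add: row_def card_cartesian_product)
    finally have "prob {\<omega> \<in> space M. \<forall>k\<in>{1..K}. X k t \<omega>} = p ^ K" .
    moreover have "{\<omega> \<in> space M. \<forall>k\<in>{1..K}. X k t \<omega>} \<in> events"
      using meas t by measurable
    ultimately show ?thesis
      using prob_neg[of "\<lambda>\<omega>. \<forall>k\<in>{1..K}. X k t \<omega>"] by simp
  qed
  have "prob {\<omega> \<in> space M. \<forall>t\<in>{1..L}. \<not> (\<forall>k\<in>{1..K}. X k t \<omega>)} = (1 - p ^ K) ^ L"
    using prob_ball_indep[OF rows] \<open>L \<ge> 1\<close> row_prob by simp
  moreover have "{\<omega> \<in> space M. \<exists>t\<in>{1..L}. \<forall>k\<in>{1..K}. X k t \<omega>} \<in> events"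
    using meas by measurable
  ultimately show ?thesis
    using prob_neg[of "\<lambda>\<omega>. \<exists>t\<in>{1..L}. \<forall>k\<in>{1..K}. X k t \<omega>"] by simp
qed

text \<open>Powers with positive exponent are strictly increasing on nonnegative reals, and the two
  complements reverse the order twice. The upper bounds on \<open>p\<close> and \<open>q\<close>
  keep the bases \<open>1 - p ^ K\<close> and \<open>1 - q ^ K\<close> nonnegative.\<close>

lemma amplification_less_iff:
  fixes p q :: real
  assumes "0 \<le> p" "p \<le> 1" "0 \<le> q" "q \<le> 1" "K \<ge> 1" "L \<ge> 1"
  shows "1 - (1 - p ^ K) ^ L < 1 - (1 - q ^ K) ^ L \<longleftrightarrow> p < q"
proof -
  have "0 \<le> 1 - p ^ K" "0 \<le> 1 - q ^ K"
    using assms by (simp_all add: power_le_one)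
  then have "(1 - p ^ K) ^ L \<le> (1 - q ^ K) ^ L \<longleftrightarrow> 1 - p ^ K \<le> 1 - q ^ K"
    using \<open>L \<ge> 1\<close> by (intro power_mono_iff) simp_all
  moreover have "q ^ K \<le> p ^ K \<longleftrightarrow> q \<le> p"
    using assms by (intro power_mono_iff) simp_all
  ultimately show ?thesis by linarith
qed

text \<open>Retrieval depends on the hash functions only through their agreement on
  \<open>w y\<close> and \<open>w i\<close>, so the function-valued variables reduce to an
  independent Boolean array.\<close>

lemma lsh_label_prob_eq:
  fixes H :: "(real ^ 'd \<Rightarrow> 'b) measure"
  assumes H: "\<forall>u v. {g \<in> space H. g u = g v} \<in> sets H"
    and "K \<ge> 1" "L \<ge> 1" and iid: "iid_hashes M H K L h"
    and i: "i \<in> {1..N} - {y}"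
  shows "lsh_label_prob M K L h N w (x, y) i = 1 - (1 - collision_prob H (w y) (w i) ^ K) ^ L"
proof -
  interpret prob_space M using iid by (simp add: iid_hashes_def)
  define X where "X k t \<omega> \<longleftrightarrow> h k t \<omega> (w y) = h k t \<omega> (w i)" for k t \<omega>
  have ind: "indep_vars (\<lambda>_. H) (\<lambda>(k, t). h k t) ({1..K} \<times> {1..L})"
    using iid by (simp add: iid_hashes_def)
  have col: "Measurable.pred H (\<lambda>g. g (w y) = g (w i))"
    using H by (simp add: pred_def)
  have "indep_vars (\<lambda>_. count_space UNIV) (\<lambda>j. (\<lambda>g. g (w y) = g (w i)) \<circ> (case j of (k, t) \<Rightarrow> h k t))
      ({1..K} \<times> {1..L})"
    by (rule indep_vars_compose[OF ind col])
  moreover have "(\<lambda>j. (\<lambda>g. g (w y) = g (w i)) \<circ> (case j of (k, t) \<Rightarrow> h k t)) = (\<lambda>(k, t). X k t)"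
    by (auto simp: X_def fun_eq_iff)
  ultimately have "indep_vars (\<lambda>_. count_space UNIV) (\<lambda>(k, t). X k t) ({1..K} \<times> {1..L})" by simp
  moreover have "prob {\<omega> \<in> space M. X k t \<omega>} = collision_prob H (w y) (w i)"
    if "k \<in> {1..K}" "t \<in> {1..L}" for k t
  proof -
    have h: "h k t \<in> measurable M H" and d: "distr M H (h k t) = H"
      using ind iid that by (fastforce simp: indep_vars_def iid_hashes_def)+
    \<comment> \<open>Since \<open>h k t\<close> has law \<open>H\<close>, the collision event pulls
      back to \<open>M\<close> with the same probability.\<close>
    have "collision_prob H (w y) (w i) = measure (distr M H (h k t)) {g \<in> space H. g (w y) = g (w i)}"
      by (simp add: collision_prob_def d)
    also have "\<dots> = prob (h k t -` {g \<in> space H. g (w y) = g (w i)} \<inter> space M)"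
      using h H by (intro measure_distr) auto
    also have "h k t -` {g \<in> space H. g (w y) = g (w i)} \<inter> space M = {\<omega> \<in> space M. X k t \<omega>}"
      using measurable_space[OF h] by (auto simp: X_def)
    finally show ?thesis by simp
  qed
  ultimately have "prob {\<omega> \<in> space M. \<exists>t\<in>{1..L}. \<forall>k\<in>{1..K}. X k t \<omega>}
      = 1 - (1 - collision_prob H (w y) (w i) ^ K) ^ L"
    using \<open>K \<ge> 1\<close> \<open>L \<ge> 1\<close> by (rule prob_bex_ball_indep)
  moreover have "i \<in> lsh_label_negatives K L (\<lambda>k t. h k t \<omega>) N w (x, y)
      \<longleftrightarrow> (\<exists>t\<in>{1..L}. \<forall>k\<in>{1..K}. X k t \<omega>)" for \<omega>
  proof -
    \<comment> \<open>Two meta-hashes, being maps over the same list, are equal iff they agree at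
      every index in its set.\<close>
    have "set [1..<Suc K] = {1..K}" by auto
    then have "meta_hash K (\<lambda>k t. h k t \<omega>) t (w i) = meta_hash K (\<lambda>k t. h k t \<omega>) t (w y)
        \<longleftrightarrow> (\<forall>k\<in>{1..K}. X k t \<omega>)" for t
      unfolding meta_hash_def map_eq_conv X_def by metis
    \<comment> \<open>As \<open>i\<close> lies in \<open>{1..N}\<close> it is stored in every table,
      and as it differs from \<open>y\<close> the removal of \<open>y\<close> does not affect
      it.\<close>
    then show ?thesis
      using i by (simp add: lsh_label_negatives_def retrieved_def bucket_def)
  qed
  ultimately show ?thesis by (simp add: lsh_label_prob_def)
qed


theorem theorem1:
  fixes H :: "(real ^ 'd \<Rightarrow> 'b) measure"
    and sim :: "real ^ 'd \<Rightarrow> real ^ 'd \<Rightarrow> real"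
    and M :: "'a measure"
    and h :: "nat \<Rightarrow> nat \<Rightarrow> 'a \<Rightarrow> (real ^ 'd \<Rightarrow> 'b)"
    and w :: "nat \<Rightarrow> real ^ 'd"
    and x :: 'x and y N K L :: nat
  assumes "lsh_family H sim"
    and "K \<ge> 1" and "L \<ge> 1"
    and "iid_hashes M H K L h"
    and "y \<in> {1..N}"
  shows "(\<exists>c::real. c > 0 \<and>
            (\<forall>i\<in>{1..N} - {y}.
               lsh_label_prob M K L h N w (x, y) i
                 = c * (1 - (1 - collision_prob H (w y) (w i) ^ K) ^ L))) \<and>
         (\<forall>i\<in>{1..N} - {y}. \<forall>j\<in>{1..N} - {y}.
            lsh_label_prob M K L h N w (x, y) i > lsh_label_prob M K L h N w (x, y) j
              \<longleftrightarrow> sim (w y) (w i) > sim (w y) (w j))"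
proof -
  obtain f where f: "strict_mono_on (range (\<lambda>(u, v). sim u v)) f"
      "\<And>u v. collision_prob H u v = f (sim u v)"
    and H: "prob_space H" "\<forall>u v. {g \<in> space H. g u = g v} \<in> sets H"
    using assms(1) by (auto simp: lsh_family_def)
  have unit: "0 \<le> collision_prob H u v" "collision_prob H u v \<le> 1" for u v
    using H(1) by (simp_all add: collision_prob_def prob_space.prob_le_1)
  have p: "lsh_label_prob M K L h N w (x, y) i = 1 - (1 - collision_prob H (w y) (w i) ^ K) ^ L"
    if "i \<in> {1..N} - {y}" for i
    using lsh_label_prob_eq[OF H(2) assms(2-4) that] .
  have "collision_prob H u a < collision_prob H u b \<longleftrightarrow> sim u a < sim u b" for u a b
    \<comment> \<open>Both arguments of \<open>f\<close> are values of \<open>sim\<close>, where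
      \<open>f\<close> is strictly monotone and so also reflects the order.\<close>
    unfolding f(2) by (rule strict_mono_on_less[OF f(1)]) auto
  then have "lsh_label_prob M K L h N w (x, y) j < lsh_label_prob M K L h N w (x, y) i
      \<longleftrightarrow> sim (w y) (w j) < sim (w y) (w i)"
    if "i \<in> {1..N} - {y}" "j \<in> {1..N} - {y}" for i j
    using that assms(2,3) unit by (simp only: p amplification_less_iff)
  moreover have "\<exists>c::real. c > 0 \<and> (\<forall>i\<in>{1..N} - {y}. lsh_label_prob M K L h N w (x, y) i
      = c * (1 - (1 - collision_prob H (w y) (w i) ^ K) ^ L))"
    using p by (intro exI[of _ 1]) simp
  ultimately show ?thesis by blast
qed

end
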